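(* Let $m>0$ and $\lambda_1,\lambda_2,\lambda_3>0$ be constants, and let $\theta_f,\theta_c,\theta_\phi$ be (finite-dimensional real vector) parameter groups. Fix a data point $(z,y)$ and a finite dataset $\mathcal{D}$, and consider the Lagrangian $$L = T - \mathcal{L}(f(z;\theta_f),y) - \lambda_1\sum_{w=1}^{l}\sum_{z_i\in\mathcal{D}}\mathbb{I}_{\Delta c_w^{[h]}(z,z_i)>0}\,\gamma(-\Delta c_w(z,z_i;\theta_c)) - \lambda_2\left(1-\frac{\|Q_c^\top Q_f\|_F^2}{\mathrm{rank}(\nabla_z f)}\right) - \lambda_3 K^{[h]}\big(\phi(c(z;\theta_c);\theta_\phi),\dots,\nabla_c^{(n)}\phi(c(z;\theta_c);\theta_\phi)\big),$$ where $T=\sum_{i\in\{f,c,\phi\}}\tfrac12 m(\partial_t\theta_i)^\top(\partial_t\theta_i)$ and every term of $L$ other than $T$ is a differentiable function of the parameters. Then, for twice differentiable curves $t\mapsto\theta_f(t),\theta_c(t),\theta_\phi(t)$, the Euler--Lagrange equations $$\frac{d}{dt}\left(\frac{\partial L}{\partial(\partial_t\theta_i)}\right)-\frac{\partial L}{\partial\theta_i}=0,\qquad i\in\{f,c,\phi\},$$ yield $$m\frac{\partial^2\theta_f}{\partial t^2}=-\nabla_{\theta_f}\mathcal{L}(f(z;\theta_f),y)-\lambda_2\nabla_{\theta_f}\left(1-\frac{\|Q_c^\top Q_f\|_F^2}{\mathrm{rank}(\nabla_z f)}\right),$$ $$m\frac{\partial^2\theta_c}{\partial t^2}=-\lambda_1\sum_{w=1}^{l}\sum_{z_i\in\mathcal{D}}\mathbb{I}_{\Delta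 c_w^{[h]}(z,z_i)>0}\,\nabla_{\theta_c}\gamma(-\Delta c_w(z,z_i;\theta_c))-\lambda_2\nabla_{\theta_c}\left(1-\frac{\|Q_c^\top Q_f\|_F^2}{\mathrm{rank}(\nabla_z f)}\right)-\lambda_3\nabla_{\theta_c}K^{[h]}\big(\phi(c(z;\theta_c);\theta_\phi),\dots,\nabla_c^{(n)}\phi(c(z;\theta_c);\theta_\phi)\big),$$ $$m\frac{\partial^2\theta_\phi}{\partial t^2}=-\lambda_3\nabla_{\theta_\phi}K^{[h]}\big(\phi(c(z;\theta_c);\theta_\phi),\dots,\nabla_c^{(n)}\phi(c(z;\theta_c);\theta_\phi)\big).$$
   Context: A model $f(\cdot;\theta_f)$ maps inputs $z$ (real vectors) to real vectors and depends only on the parameters $\theta_f$. Concept maps $c(\cdot;\theta_c)=(c_1,\dots,c_l)$ map inputs to $\mathbb{R}^l$ and depend only on $\theta_c$. A concept formula $\phi(\cdot;\theta_\phi)$ is a function on $\mathbb{R}^l$ depending only on $\theta_\phi$. $\mathcal{L}(\cdot,\cdot)$ is a real-valued loss. $c_w^{[h]}$ are fixed real-valued functions of the input (independent of all parameters). $\Delta c_w(z,z_i;\theta_c)=c_w(z;\theta_c)-c_w(z_i;\theta_c)$ and $\Delta c_w^{[h]}(z,z_i)=c_w^{[h]}(z)-c_w^{[h]}(z_i)$; $\mathbb{I}_{P}$ is $1$ if $P$ holds and $0$ otherwise; $\gamma\colon\mathbb{R}\to\mathbb{R}_{\ge0}$ is a fixed function. $Q_c$ (depending only on $\theta_c$)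 and $Q_f$ (depending only on $\theta_f$) are matrices whose columns are orthonormal bases of the row spaces of the Jacobians $\nabla_z c$ and $\nabla_z f$ at $z$; $\|\cdot\|_F$ is the Frobenius norm. $K^{[h]}$ is a fixed real-valued expression in $\phi$ and its derivatives $\nabla_c\phi,\dots,\nabla_c^{(n)}\phi$ with respect to the concept variables, evaluated at $c(z;\theta_c)$. In the Euler--Lagrange equations, $L$ is regarded as a function of the independent variables $\theta_i$ and $\partial_t\theta_i$. *)

theory Defs
  imports "HOL-Analysis.Analysis"
begin

definition gradient :: "('a::real_inner \<Rightarrow> real) \<Rightarrow> 'a \<Rightarrow> 'a" where
  "gradient F x = (THE D. GDERIV F x :> D)"

definition velocity :: "(real \<Rightarrow> 'a::real_normed_vector) \<Rightarrow> real \<Rightarrow> 'a" where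
  "velocity q t = vector_derivative q (at t)"

definition acceleration :: "(real \<Rightarrow> 'a::real_normed_vector) \<Rightarrow> real \<Rightarrow> 'a" where
  "acceleration q t = vector_derivative (velocity q) (at t)"

definition twice_differentiable_curve_on ::
  "real set \<Rightarrow> (real \<Rightarrow> 'a::real_normed_vector) \<Rightarrow> bool" where
  "twice_differentiable_curve_on S q \<longleftrightarrow>
     (\<forall>t\<in>S. q differentiable (at t) \<and> velocity q differentiable (at t))"

(* Left-hand side of the Euler-Lagrange equation of one parameter group with curve q.
   Lag t x v is the Lagrangian as a function of the independent variables x (position) and
   v (velocity) of that group; its dependence on t carries the positions and velocities of the
   other groups, which are held at their values along their curves in the partial gradients. *)
definition euler_lagrange_lhs ::
  "(real \<Rightarrow> 'a \<Rightarrow> 'a \<Rightarrow> real) \<Rightarrow> (real \<Rightarrow> 'a::real_inner) \<Rightarrow> real \<Rightarrow> 'a" where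
  "euler_lagrange_lhs Lag q t =
     vector_derivative (\<lambda>s. gradient (\<lambda>v. Lag s (q s) v) (velocity q s)) (at t)
     - gradient (\<lambda>x. Lag t x (velocity q t)) (q t)"

(* The number of columns of Q_c and Q_f is the rank of a Jacobian, hence may vary with the
   parameters.  Such a matrix is therefore represented by the list of its columns. *)
definition orthonormal_basis_columns :: "(real^'d) list \<Rightarrow> (real^'d) set \<Rightarrow> bool" where
  "orthonormal_basis_columns Q V \<longleftrightarrow>
     (\<forall>i<length Q. \<forall>j<length Q. Q ! i \<bullet> Q ! j = (if i = j then 1 else 0)) \<and> span (set Q) = V"

definition row_space :: "real^'d^'m \<Rightarrow> (real^'d) set" where
  "row_space A = span (rows A)"

(* Entry (i, j) of the matrix product of the transpose of Q with P. *)
definition transpose_times :: "(real^'d) list \<Rightarrow> (real^'d) list \<Rightarrow> nat \<Rightarrow> nat \<Rightarrow> real" where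
  "transpose_times Q P i j = (\<Sum>k\<in>UNIV. (Q ! i) $ k * (P ! j) $ k)"

definition frobenius_norm :: "nat \<Rightarrow> nat \<Rightarrow> (nat \<Rightarrow> nat \<Rightarrow> real) \<Rightarrow> real" where
  "frobenius_norm r s M = sqrt (\<Sum>i<r. \<Sum>j<s. (M i j)\<^sup>2)"

definition subspace_term ::
  "(real^'d) list \<Rightarrow> (real^'d) list \<Rightarrow> real^'d^'k \<Rightarrow> real" where
  "subspace_term Qc Qf Jf =
     1 - (frobenius_norm (length Qc) (length Qf) (transpose_times Qc Qf))\<^sup>2 / real (rank Jf)"

definition concept_diff :: "(real^'d \<Rightarrow> real^'l) \<Rightarrow> 'l \<Rightarrow> real^'d \<Rightarrow> real^'d \<Rightarrow> real" where
  "concept_diff c w z z' = c z $ w - c z' $ w"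

(* ch is the parameter-free concept map c^[h], ct the concept map c at the current parameter. *)
definition concept_term ::
  "(real \<Rightarrow> real) \<Rightarrow> (real^'d \<Rightarrow> real^'l) \<Rightarrow> (real^'d \<Rightarrow> real^'l) \<Rightarrow> 'l \<Rightarrow> real^'d \<Rightarrow> real^'d \<Rightarrow> real"
  where
  "concept_term \<gamma> ch ct w z z' =
     of_bool (concept_diff ch w z z' > 0) * \<gamma> (- concept_diff ct w z z')"

primrec partial_derivs ::
  "'l list \<Rightarrow> (real^'l \<Rightarrow> 'o::real_normed_vector) \<Rightarrow> real^'l \<Rightarrow> 'o" where
  "partial_derivs [] g = g"
| "partial_derivs (i # is) g = (\<lambda>x. frechet_derivative (partial_derivs is g) (at x) (axis i 1))"

(* The order-k derivative as the array of its k-fold partial derivatives: entry (i_1, ..., i_k) is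
   the value at the list [i_1, ..., i_k]; lists of any other length carry no information. *)
definition nabla :: "nat \<Rightarrow> (real^'l \<Rightarrow> 'o::real_normed_vector) \<Rightarrow> real^'l \<Rightarrow> 'l list \<Rightarrow> 'o" where
  "nabla k g x = (\<lambda>is. if length is = k then partial_derivs is g x else 0)"

(* K applied to the value of g at x and to the list of its derivatives of orders 1, ..., n at x. *)
definition formula_term ::
  "('o \<Rightarrow> ('l list \<Rightarrow> 'o) list \<Rightarrow> real) \<Rightarrow> nat \<Rightarrow> (real^'l \<Rightarrow> 'o::real_normed_vector) \<Rightarrow> real^'l \<Rightarrow> real"
  where
  "formula_term K n g x = K (g x) (map (\<lambda>k. nabla k g x) [1..<Suc n])"

end

theory Submission
  imports Defs
begin

text \<open>For each parameter group, \<open>L\<close> splits as kinetic energy of the group, plus a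
  part \<open>C\<close> free of its position and velocity, minus a potential \<open>U\<close> in its
  position alone. The velocity gradient of \<open>L\<close> is therefore m times the velocity, with
  time derivative m times the acceleration, and the position gradient is minus that of
  \<open>U\<close>. The Euler-Lagrange equation thus becomes Newton's law, mass times acceleration
  equals minus the gradient of the potential; this is \<open>euler_lagrange_imp_newton\<close>,
  applied once per group. What remains is to compute the gradient of each \<open>U\<close> by
  linearity. \<open>differentiable_imp_GDERIV_gradient\<close> and
  \<open>differentiable_Pair_slices\<close> supply the gradients of its summands,
  \<open>GDERIV_concept_term\<close> those of the concept terms.\<close>

text \<open>Derivatives are unique and a vector is determined by its inner products, so the definite
  description in \<open>gradient\<close> can only pick \<open>D\<close>.\<close>

lemma gradient_eqI:
  assumes "GDERIV F x :> D"
  shows "gradient F x = D"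
  unfolding gradient_def
proof (rule the_equality)
  show "GDERIV F x :> D" by (fact assms)
next
  fix D' assume "GDERIV F x :> D'"
  then have "(\<lambda>h. h \<bullet> D') = (\<lambda>h. h \<bullet> D)"
    using assms unfolding gderiv_def by (rule has_derivative_unique)
  then show "D' = D"
    by (metis vector_eq_ldot)
qed

text \<open>Riesz representation in finite dimension: the derivative, a linear functional, is the
  inner product with a fixed vector. This turns differentiability assumptions into statements about
  \<open>gradient\<close>.\<close>

lemma differentiable_imp_GDERIV_gradient:
  fixes F :: "'a::euclidean_space \<Rightarrow> real"
  assumes "F differentiable (at x)"
  shows "GDERIV F x :> gradient F x"
proof -
  obtain F' where F': "(F has_derivative F') (at x)"
    using assms unfolding differentiable_def by blast
  \<comment> \<open>The adjoint maps the reals back into the space, and its value at 1 is the Riesz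
    vector of \<open>F'\<close>.\<close>
  have "h \<bullet> adjoint F' 1 = F' h" for h
    using adjoint_works[OF has_derivative_linear[OF F'], of h 1] by simp
  then have "GDERIV F x :> adjoint F' 1"
    using F' by (simp add: gderiv_def)
  then show ?thesis
    using gradient_eqI by metis
qed

lemma GDERIV_sum:
  assumes "\<And>i. i \<in> I \<Longrightarrow> GDERIV (F i) x :> D i"
  shows "GDERIV (\<lambda>y. \<Sum>i\<in>I. F i y) x :> (\<Sum>i\<in>I. D i)"
  unfolding gderiv_def inner_sum_right
  using assms by (intro has_derivative_sum) (simp add: gderiv_def)

lemma GDERIV_cmult:
  assumes "GDERIV F x :> D"
  shows "GDERIV (\<lambda>y. a * F y) x :> a *\<^sub>R D"
  using assms has_derivative_mult_right[of F "\<lambda>h. h \<bullet> D" "at x" a] by (simp add: gderiv_def)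

lemma gradient_kinetic:
  "gradient (\<lambda>v. 1/2 * m * (v \<bullet> v) + C) u = m *\<^sub>R (u::'a::real_inner)"
proof (rule gradient_eqI)
  show "GDERIV (\<lambda>v. 1/2 * m * (v \<bullet> v) + C) u :> m *\<^sub>R u"
    unfolding gderiv_def
    by (auto intro!: derivative_eq_intros ext simp: inner_commute)
qed

text \<open>The time argument of \<open>C\<close> and \<open>U\<close> carries the other groups
  along their curves. Both gradients freeze it, and the outer time derivative meets only m times the
  velocity.\<close>

lemma euler_lagrange_imp_newton:
  fixes q :: "real \<Rightarrow> 'a::euclidean_space"
  assumes EL: "euler_lagrange_lhs Lag q t = 0"
    and Lag: "\<And>s x v. Lag s x v = 1/2 * m * (v \<bullet> v) + C s - U s x"
    and vel: "velocity q differentiable (at t)"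
    and U: "GDERIV (U t) (q t) :> D"
  shows "m *\<^sub>R acceleration q t = - D"
proof -
  \<comment> \<open>Needed for every \<open>s\<close>, since this function of \<open>s\<close> is
    differentiated next. With \<open>q s\<close> fixed, \<open>C s - U s (q s)\<close> is the
    additive constant of \<open>gradient_kinetic\<close>.\<close>
  have "gradient (\<lambda>v. Lag s (q s) v) (velocity q s) = m *\<^sub>R velocity q s" for s
    using gradient_kinetic[of m "C s - U s (q s)"] by (simp add: Lag algebra_simps)
  moreover have "((\<lambda>s. m *\<^sub>R velocity q s) has_vector_derivative m *\<^sub>R acceleration q t) (at t)"
    using vel unfolding acceleration_def vector_derivative_works
    by (auto intro!: derivative_eq_intros)
  moreover have "gradient (\<lambda>x. Lag t x (velocity q t)) (q t) = - D"
    unfolding Lag using GDERIV_diff[OF GDERIV_const U] by (intro gradient_eqI) simp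
  ultimately show ?thesis
    using EL by (simp add: euler_lagrange_lhs_def vector_derivative_at eq_neg_iff_add_eq_0)
qed

text \<open>Fixing one coordinate is composition with an affine embedding into the product, so the
  chain rule applies. The subspace and formula terms each couple two groups, and their partial
  gradients come from here.\<close>

lemma differentiable_Pair_slices:
  assumes "(\<lambda>(x, y). G x y) differentiable_on UNIV"
  shows "(\<lambda>x. G x b) differentiable (at a)" and "G a differentiable (at b)"
proof -
  have G: "(\<lambda>p. G (fst p) (snd p)) differentiable (at (a, b))"
    using assms by (simp add: differentiable_on_def case_prod_beta')
  have "(\<lambda>x. (x, b)) differentiable (at a)" "Pair a differentiable (at b)"
    by (auto simp: differentiable_def intro!: exI derivative_intros)
  then show "(\<lambda>x. G x b) differentiable (at a)" "G a differentiable (at b)"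
    using differentiable_chain_at[of "\<lambda>x. (x, b)" a, OF _ G]
      differentiable_chain_at[of "Pair a" b, OF _ G] by (simp_all add: o_def)
qed

text \<open>Where the indicator vanishes, the factor \<open>\<gamma> (\<dots>)\<close> need not be differentiable and its
  gradient may be a junk value; the zero coefficient discards it.\<close>

lemma GDERIV_concept_term:
  fixes c :: "'a::euclidean_space \<Rightarrow> real^'d \<Rightarrow> real^'l"
  assumes "(\<lambda>x. concept_term \<gamma> ch (c x) w z z') differentiable (at a)"
  shows "GDERIV (\<lambda>x. concept_term \<gamma> ch (c x) w z z') a :>
    of_bool (concept_diff ch w z z' > 0) *\<^sub>R gradient (\<lambda>x. \<gamma> (- concept_diff (c x) w z z')) a"
proof (cases "concept_diff ch w z z' > 0")
  case True
  then show ?thesis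
    using differentiable_imp_GDERIV_gradient[OF assms] by (simp add: concept_term_def)
next
  case False
  then show ?thesis
    using GDERIV_const by (simp add: concept_term_def)
qed

theorem lemmaD1:
  fixes m lam1 lam2 lam3 :: real
    and f :: "'pf::euclidean_space \<Rightarrow> real^'d \<Rightarrow> real^'k"
    and c :: "'pc::euclidean_space \<Rightarrow> real^'d \<Rightarrow> real^'l"
    and \<phi> :: "'pp::euclidean_space \<Rightarrow> real^'l \<Rightarrow> 'o::euclidean_space"
    and Loss :: "real^'k \<Rightarrow> 'y \<Rightarrow> real"
    and ch :: "real^'d \<Rightarrow> real^'l"
    and \<gamma> :: "real \<Rightarrow> real"
    and K :: "'o \<Rightarrow> ('l list \<Rightarrow> 'o) list \<Rightarrow> real"
    and n :: nat
    and z :: "real^'d" and y :: 'y and \<D> :: "(real^'d) set"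
    and Qc :: "'pc \<Rightarrow> (real^'d) list" and Qf :: "'pf \<Rightarrow> (real^'d) list"
    and L :: "'pf \<Rightarrow> 'pc \<Rightarrow> 'pp \<Rightarrow> 'pf \<Rightarrow> 'pc \<Rightarrow> 'pp \<Rightarrow> real"
    and S :: "real set"
    and \<theta>f :: "real \<Rightarrow> 'pf" and \<theta>c :: "real \<Rightarrow> 'pc" and \<theta>p :: "real \<Rightarrow> 'pp"
  assumes pos: "m > 0" "lam1 > 0" "lam2 > 0" "lam3 > 0"
    and \<gamma>_nonneg: "\<And>x. \<gamma> x \<ge> 0"
    and finite_data: "finite \<D>"
    and Qc: "\<And>a. orthonormal_basis_columns (Qc a) (row_space (jacobian (c a) (at z)))"
    and Qf: "\<And>a. orthonormal_basis_columns (Qf a) (row_space (jacobian (f a) (at z)))"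
    and L: "\<And>xf xc xp vf vc vp. L xf xc xp vf vc vp =
          (1/2 * m * (vf \<bullet> vf) + 1/2 * m * (vc \<bullet> vc) + 1/2 * m * (vp \<bullet> vp))
          - Loss (f xf z) y
          - lam1 * (\<Sum>w\<in>UNIV. \<Sum>zi\<in>\<D>. concept_term \<gamma> ch (c xc) w z zi)
          - lam2 * subspace_term (Qc xc) (Qf xf) (jacobian (f xf) (at z))
          - lam3 * formula_term K n (\<phi> xp) (c xc z)"
    and diff_loss: "(\<lambda>xf. Loss (f xf z) y) differentiable_on UNIV"
    and diff_concept: "\<And>w zi. zi \<in> \<D> \<Longrightarrow>
          (\<lambda>xc. concept_term \<gamma> ch (c xc) w z zi) differentiable_on UNIV"
    and diff_subspace: "(\<lambda>(xf, xc). subspace_term (Qc xc) (Qf xf) (jacobian (f xf) (at z)))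
          differentiable_on UNIV"
    and diff_formula: "(\<lambda>(xc, xp). formula_term K n (\<phi> xp) (c xc z)) differentiable_on UNIV"
    and time: "open S" "is_interval S"
    and curves: "twice_differentiable_curve_on S \<theta>f" "twice_differentiable_curve_on S \<theta>c"
          "twice_differentiable_curve_on S \<theta>p"
    and EL_f: "\<And>t. t \<in> S \<Longrightarrow> euler_lagrange_lhs
          (\<lambda>s x v. L x (\<theta>c s) (\<theta>p s) v (velocity \<theta>c s) (velocity \<theta>p s)) \<theta>f t = 0"
    and EL_c: "\<And>t. t \<in> S \<Longrightarrow> euler_lagrange_lhs
          (\<lambda>s x v. L (\<theta>f s) x (\<theta>p s) (velocity \<theta>f s) v (velocity \<theta>p s)) \<theta>c t = 0"
    and EL_p: "\<And>t. t \<in> S \<Longrightarrow> euler_lagrange_lhs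
          (\<lambda>s x v. L (\<theta>f s) (\<theta>c s) x (velocity \<theta>f s) (velocity \<theta>c s) v) \<theta>p t = 0"
  shows "\<forall>t\<in>S.
      m *\<^sub>R acceleration \<theta>f t =
        - gradient (\<lambda>xf. Loss (f xf z) y) (\<theta>f t)
        - lam2 *\<^sub>R gradient (\<lambda>xf. subspace_term (Qc (\<theta>c t)) (Qf xf) (jacobian (f xf) (at z))) (\<theta>f t)
    \<and> m *\<^sub>R acceleration \<theta>c t =
        - lam1 *\<^sub>R (\<Sum>w\<in>UNIV. \<Sum>zi\<in>\<D>. of_bool (concept_diff ch w z zi > 0) *\<^sub>R
            gradient (\<lambda>xc. \<gamma> (- concept_diff (c xc) w z zi)) (\<theta>c t))
        - lam2 *\<^sub>R gradient (\<lambda>xc. subspace_term (Qc xc) (Qf (\<theta>f t)) (jacobian (f (\<theta>f t)) (at z))) (\<theta>c t)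
        - lam3 *\<^sub>R gradient (\<lambda>xc. formula_term K n (\<phi> (\<theta>p t)) (c xc z)) (\<theta>c t)
    \<and> m *\<^sub>R acceleration \<theta>p t =
        - lam3 *\<^sub>R gradient (\<lambda>xp. formula_term K n (\<phi> xp) (c (\<theta>c t) z)) (\<theta>p t)"
proof (intro ballI conjI)
  fix t assume t: "t \<in> S"
  have vel: "velocity \<theta>f differentiable (at t)" "velocity \<theta>c differentiable (at t)"
    "velocity \<theta>p differentiable (at t)"
    using curves t by (auto simp: twice_differentiable_curve_on_def)
  let ?kin = "\<lambda>v. 1/2 * m * (v \<bullet> v)"
  let ?loss = "\<lambda>xf. Loss (f xf z) y"
  let ?concept = "\<lambda>xc. \<Sum>w\<in>UNIV. \<Sum>zi\<in>\<D>. concept_term \<gamma> ch (c xc) w z zi"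
  let ?sub = "\<lambda>xf xc. subspace_term (Qc xc) (Qf xf) (jacobian (f xf) (at z))"
  let ?form = "\<lambda>xc xp. formula_term K n (\<phi> xp) (c xc z)"
  let ?dconcept = "\<Sum>w\<in>UNIV. \<Sum>zi\<in>\<D>. of_bool (concept_diff ch w z zi > 0) *\<^sub>R
      gradient (\<lambda>xc. \<gamma> (- concept_diff (c xc) w z zi)) (\<theta>c t)"
  note grad = differentiable_imp_GDERIV_gradient
  have loss: "GDERIV ?loss (\<theta>f t) :> gradient ?loss (\<theta>f t)"
    using diff_loss by (intro grad) (simp add: differentiable_on_def)
  \<comment> \<open>The gradient passes through both sums and then past the indicator, which does
    not depend on the parameters.\<close>
  have concept: "GDERIV ?concept (\<theta>c t) :> ?dconcept"
    using diff_concept by (intro GDERIV_sum GDERIV_concept_term) (simp add: differentiable_on_def)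
  note sub = differentiable_Pair_slices[OF diff_subspace, THEN grad]
  note form = differentiable_Pair_slices[OF diff_formula, THEN grad]

  \<comment> \<open>\<open>U\<close> collects the terms containing \<theta>f, with the concept
    parameters at their current value; everything else goes into \<open>C\<close>.\<close>
  have "m *\<^sub>R acceleration \<theta>f t =
      - (gradient ?loss (\<theta>f t) + lam2 *\<^sub>R gradient (\<lambda>xf. ?sub xf (\<theta>c t)) (\<theta>f t))"
  proof (rule euler_lagrange_imp_newton[OF EL_f[OF t] _ vel(1),
        where U = "\<lambda>s x. ?loss x + lam2 * ?sub x (\<theta>c s)"
          and C = "\<lambda>s. ?kin (velocity \<theta>c s) + ?kin (velocity \<theta>p s)
            - lam1 * ?concept (\<theta>c s) - lam3 * ?form (\<theta>c s) (\<theta>p s)"])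
  \<comment> \<open>Two goals are left: the splitting of \<open>L\<close>, by unfolding, and the
    gradient of \<open>U\<close>, by linearity.\<close>
  qed (simp add: L, intro GDERIV_add GDERIV_cmult loss sub(1))
  then show "m *\<^sub>R acceleration \<theta>f t =
      - gradient ?loss (\<theta>f t) - lam2 *\<^sub>R gradient (\<lambda>xf. ?sub xf (\<theta>c t)) (\<theta>f t)"
    by simp

  \<comment> \<open>The concept parameters enter every term but the loss, so \<open>U\<close> has
    three summands.\<close>
  have "m *\<^sub>R acceleration \<theta>c t =
      - (lam1 *\<^sub>R ?dconcept + lam2 *\<^sub>R gradient (?sub (\<theta>f t)) (\<theta>c t)
        + lam3 *\<^sub>R gradient (\<lambda>xc. ?form xc (\<theta>p t)) (\<theta>c t))"
  proof (rule euler_lagrange_imp_newton[OF EL_c[OF t] _ vel(2),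
        where U = "\<lambda>s x. lam1 * ?concept x + lam2 * ?sub (\<theta>f s) x + lam3 * ?form x (\<theta>p s)"
          and C = "\<lambda>s. ?kin (velocity \<theta>f s) + ?kin (velocity \<theta>p s) - ?loss (\<theta>f s)"])
  qed (simp add: L, intro GDERIV_add GDERIV_cmult concept sub(2) form(1))
  then show "m *\<^sub>R acceleration \<theta>c t =
      - lam1 *\<^sub>R ?dconcept - lam2 *\<^sub>R gradient (?sub (\<theta>f t)) (\<theta>c t)
        - lam3 *\<^sub>R gradient (\<lambda>xc. ?form xc (\<theta>p t)) (\<theta>c t)"
    by simp

  \<comment> \<open>Only the formula term contains the parameters of \<phi>, so it alone exerts a
    force on them.\<close>
  have "m *\<^sub>R acceleration \<theta>p t = - (lam3 *\<^sub>R gradient (?form (\<theta>c t)) (\<theta>p t))"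
  proof (rule euler_lagrange_imp_newton[OF EL_p[OF t] _ vel(3),
        where U = "\<lambda>s x. lam3 * ?form (\<theta>c s) x"
          and C = "\<lambda>s. ?kin (velocity \<theta>f s) + ?kin (velocity \<theta>c s) - ?loss (\<theta>f s)
            - lam1 * ?concept (\<theta>c s) - lam2 * ?sub (\<theta>f s) (\<theta>c s)"])
  qed (simp add: L, intro GDERIV_cmult form(2))
  then show "m *\<^sub>R acceleration \<theta>p t = - lam3 *\<^sub>R gradient (?form (\<theta>c t)) (\<theta>p t)"
    by simp
qed

end
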